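(* Let $F$ be a 2-free word-hyperbolic group and let $A$ be an abelian group. Suppose that $E$ is a group fitting into a short exact sequence $1\to F\to E\to A\to 1$. Let $T\subset E$ be a finite generating set for a subgroup $\langle T\rangle\le E$ of exponential growth. Then there are elements of $\langle T\rangle$, each represented by a word in $T\cup T^{-1}$ of length at most $6$, that generate a non-abelian free group.
   Context: A group is 2-free if every subgroup generated by two elements is free. A finitely generated group $G$ with finite generating set $S$ has exponential growth if $\lim_{n\to\infty}\frac{\ln B_n^S}{n}>0$, where $B_n^S$ is the cardinality of the ball of radius $n$ about the identity in the word metric of $S$ (this does not depend on the choice of finite $S$). *)

theory Defs
  imports Complex_Main "HOL-Algebra.Algebra"
begin

text \<open>
  A word over \<open>S \<union> S\<inverse>\<close> is a list in \<open>lists (UNIV \<times> S)\<close>: the letter \<open>(True, x)\<close> stands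
  for \<open>x\<close> and \<open>(False, x)\<close> for the formal inverse of \<open>x\<close>.
\<close>

fun letter_value :: "('a, 'm) monoid_scheme \<Rightarrow> bool \<times> 'a \<Rightarrow> 'a" where
  "letter_value G (b, x) = (if b then x else inv\<^bsub>G\<^esub> x)"

fun word_value :: "('a, 'm) monoid_scheme \<Rightarrow> (bool \<times> 'a) list \<Rightarrow> 'a" where
  "word_value G [] = \<one>\<^bsub>G\<^esub>"
| "word_value G (l # w) = letter_value G l \<otimes>\<^bsub>G\<^esub> word_value G w"

definition reduced_word :: "(bool \<times> 'a) list \<Rightarrow> bool" where
  "reduced_word w \<longleftrightarrow> successively (\<lambda>(a, x) (b, y). \<not> (x = y \<and> a \<noteq> b)) w"

text \<open>
  \<open>B\<close> is a free basis if every element of the group is the value of exactly one reduced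
  word over \<open>B\<close>. The basis may be empty or infinite; in particular the trivial group is free.
\<close>

definition free_basis :: "('a, 'm) monoid_scheme \<Rightarrow> 'a set \<Rightarrow> bool" where
  "free_basis G B \<longleftrightarrow> B \<subseteq> carrier G \<and>
     bij_betw (word_value G) {w \<in> lists (UNIV \<times> B). reduced_word w} (carrier G)"

definition free_group :: "('a, 'm) monoid_scheme \<Rightarrow> bool" where
  "free_group G \<longleftrightarrow> group G \<and> (\<exists>B. free_basis G B)"

definition two_free :: "('a, 'm) monoid_scheme \<Rightarrow> bool" where
  "two_free G \<longleftrightarrow> group G \<and>
     (\<forall>a\<in>carrier G. \<forall>b\<in>carrier G. free_group (subgroup_generated G {a, b}))"

definition finite_generating_set :: "('a, 'm) monoid_scheme \<Rightarrow> 'a set \<Rightarrow> bool" where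
  "finite_generating_set G S \<longleftrightarrow> finite S \<and> S \<subseteq> carrier G \<and> generate G S = carrier G"

text \<open>Word length and word metric are only meaningful when \<open>S\<close> generates the group \<open>G\<close>.\<close>

definition word_length :: "('a, 'm) monoid_scheme \<Rightarrow> 'a set \<Rightarrow> 'a \<Rightarrow> nat" where
  "word_length G S g =
     (LEAST n. \<exists>w\<in>lists (UNIV \<times> S). length w = n \<and> word_value G w = g)"

definition word_dist :: "('a, 'm) monoid_scheme \<Rightarrow> 'a set \<Rightarrow> 'a \<Rightarrow> 'a \<Rightarrow> real" where
  "word_dist G S g h = real (word_length G S (inv\<^bsub>G\<^esub> g \<otimes>\<^bsub>G\<^esub> h))"

definition word_ball :: "('a, 'm) monoid_scheme \<Rightarrow> 'a set \<Rightarrow> nat \<Rightarrow> 'a set" where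
  "word_ball G S n = {g \<in> carrier G. word_dist G S \<one>\<^bsub>G\<^esub> g \<le> real n}"

text \<open>
  The limit does not depend on the finite generating set as far as its positivity is
  concerned, so quantifying existentially over \<open>S\<close> gives a property of the group.
\<close>

definition exponential_growth :: "('a, 'm) monoid_scheme \<Rightarrow> bool" where
  "exponential_growth G \<longleftrightarrow> group G \<and>
     (\<exists>S. finite_generating_set G S \<and>
       (\<exists>L>0. (\<lambda>n. ln (real (card (word_ball G S n))) / real n) \<longlonglongrightarrow> L))"

definition gromov_product :: "('a \<Rightarrow> 'a \<Rightarrow> real) \<Rightarrow> 'a \<Rightarrow> 'a \<Rightarrow> 'a \<Rightarrow> real" where
  "gromov_product d w x y = (d w x + d w y - d x y) / 2"

definition gromov_hyperbolic :: "'a set \<Rightarrow> ('a \<Rightarrow> 'a \<Rightarrow> real) \<Rightarrow> real \<Rightarrow> bool" where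
  "gromov_hyperbolic M d \<delta> \<longleftrightarrow>
     (\<forall>w\<in>M. \<forall>x\<in>M. \<forall>y\<in>M. \<forall>z\<in>M.
       gromov_product d w x z \<ge> min (gromov_product d w x y) (gromov_product d w y z) - \<delta>)"

text \<open>
  Gromov's definition: a finitely generated group is word-hyperbolic if it is a hyperbolic
  metric space (in the sense of the Gromov product) with respect to a word metric. This is
  independent of the finite generating set.
\<close>

definition word_hyperbolic :: "('a, 'm) monoid_scheme \<Rightarrow> bool" where
  "word_hyperbolic G \<longleftrightarrow> group G \<and>
     (\<exists>S. finite_generating_set G S \<and>
       (\<exists>\<delta>\<ge>0. gromov_hyperbolic (carrier G) (word_dist G S) \<delta>))"

text \<open>
  \<open>1 \<rightarrow> N \<rightarrow> G \<rightarrow> Q \<rightarrow> 1\<close>, with maps \<open>i\<close> and \<open>p\<close>. The library's \<open>short_exact_sequence\<close>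
  is not used because it forces all three carriers to have the same type.
\<close>

definition short_exact ::
  "('a, 'm) monoid_scheme \<Rightarrow> ('b, 'n) monoid_scheme \<Rightarrow> ('c, 'k) monoid_scheme
    \<Rightarrow> ('a \<Rightarrow> 'b) \<Rightarrow> ('b \<Rightarrow> 'c) \<Rightarrow> bool" where
  "short_exact N G Q i p \<longleftrightarrow> group N \<and> group G \<and> group Q \<and>
     i \<in> mon N G \<and> p \<in> epi G Q \<and> i ` carrier N = kernel G Q p"

end

theory Submission
  imports Defs
begin

text \<open>
  Regard \<open>F\<close> as a normal subgroup of \<open>E\<close>; it contains all commutators of elements of \<open>E\<close>. If two
  words of length at most 6 have values in \<open>F\<close> that do not commute, these values generate a
  non-abelian free group. Otherwise \<open>\<langle>T\<rangle>\<close> has polynomial growth, as follows. If \<open>T\<close> is not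
  commutative, take \<open>c = [s, t] \<noteq> 1\<close> with \<open>s, t \<in> T\<close>. Centralizers in a hyperbolic group are
  finitely generated, and in a 2-free group finitely many elements commuting with \<open>c \<noteq> 1\<close> have a
  common root; hence the centralizer of \<open>c\<close> in \<open>F\<close> is an infinite cyclic group \<open>\<langle>r\<rangle>\<close>. The words
  \<open>u c u\<inverse>\<close> (\<open>u \<in> T \<union> T\<inverse>\<close>) of length 6 commute with \<open>c\<close>, so \<open>u\<close> normalizes \<open>\<langle>r\<rangle>\<close> and conjugates
  \<open>r\<close> to \<open>r\<close> or \<open>r\<inverse>\<close>. All commutators of elements of \<open>T\<close> commute with \<open>c\<close> and so are powers of
  \<open>r\<close>. Therefore the value of a word of length \<open>n\<close> is determined by the number of occurrences of
  each letter and by a power of \<open>r\<close> whose exponent is quadratic in \<open>n\<close>.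
\<close>

section \<open>Words and centralizers in hyperbolic groups\<close>

lemma lists_UNIV_Times_mono:
  "\<lbrakk>w \<in> lists (UNIV \<times> S); S \<subseteq> U\<rbrakk> \<Longrightarrow> w \<in> lists (UNIV \<times> U)"
  by fastforce

lemma formal_inverse_in_lists:
  "w \<in> lists (UNIV \<times> S) \<Longrightarrow> rev (map (apfst Not) w) \<in> lists (UNIV \<times> S)"
  by fastforce

context group
begin

lemma inv_cancel_left [simp]:
  "\<lbrakk>x \<in> carrier G; y \<in> carrier G\<rbrakk> \<Longrightarrow> inv x \<otimes> (x \<otimes> y) = y"
  "\<lbrakk>x \<in> carrier G; y \<in> carrier G\<rbrakk> \<Longrightarrow> x \<otimes> (inv x \<otimes> y) = y"
  by (simp_all add: m_assoc [symmetric])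

lemma commutes_inv:
  assumes "x \<in> carrier G" "y \<in> carrier G" "x \<otimes> y = y \<otimes> x"
  shows "inv x \<otimes> y = y \<otimes> inv x"
proof -
  have "inv x \<otimes> y = inv x \<otimes> (y \<otimes> x) \<otimes> inv x"
    using assms(1,2) by (simp add: m_assoc)
  also have "\<dots> = y \<otimes> inv x"
    using assms by (simp flip: assms(3))
  finally show ?thesis .
qed

lemma letter_value_closed [simp]:
  "snd l \<in> carrier G \<Longrightarrow> letter_value G l \<in> carrier G"
  by (cases l) auto

lemma word_value_closed [simp]:
  "w \<in> lists (UNIV \<times> carrier G) \<Longrightarrow> word_value G w \<in> carrier G"
  by (induction w) auto

lemma word_value_append:
  "\<lbrakk>v \<in> lists (UNIV \<times> carrier G); w \<in> lists (UNIV \<times> carrier G)\<rbrakk>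
    \<Longrightarrow> word_value G (v @ w) = word_value G v \<otimes> word_value G w"
proof (induction v)
  case (Cons l v)
  then have "snd l \<in> carrier G" "word_value G v \<in> carrier G" "word_value G w \<in> carrier G"
    by (cases l; simp)+
  then show ?case
    using Cons by (simp add: m_assoc)
qed simp

lemma word_value_inverse:
  assumes "w \<in> lists (UNIV \<times> carrier G)"
  shows "word_value G (rev (map (apfst Not) w)) = inv (word_value G w)"
  using assms
proof (induction w)
  case (Cons l w)
  obtain b x where l: "l = (b, x)"
    by (cases l)
  have w: "rev (map (apfst Not) w) \<in> lists (UNIV \<times> carrier G)"
    using Cons.hyps formal_inverse_in_lists by blast
  have x: "x \<in> carrier G" and wv: "word_value G w \<in> carrier G"
    using Cons.hyps l by simp_all
  show ?case
    using Cons x wv w by (simp add: l word_value_append inv_mult_group)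
qed simp

lemma word_value_in_generate:
  assumes "S \<subseteq> carrier G" "w \<in> lists (UNIV \<times> S)"
  shows "word_value G w \<in> generate G S"
  using assms(2)
proof (induction w)
  case (Cons l w)
  then show ?case
    by (cases l) (simp add: generate.intros)
qed (auto intro: generate.one)

lemma generate_imp_word:
  assumes "S \<subseteq> carrier G" "g \<in> generate G S"
  shows "\<exists>w\<in>lists (UNIV \<times> S). word_value G w = g"
  using assms(2)
proof (induction rule: generate.induct)
  case one
  show ?case
    by (rule bexI[of _ "[]"]) auto
next
  case (incl h)
  then show ?case
    using assms(1) by (intro bexI[of _ "[(True, h)]"]) auto
next
  case (inv h)
  then show ?case
    using assms(1) by (intro bexI[of _ "[(False, h)]"]) auto
next
  case (eng h1 h2)
  then obtain v w where vw: "v \<in> lists (UNIV \<times> S)" "w \<in> lists (UNIV \<times> S)"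
    "word_value G v = h1" "word_value G w = h2"
    by blast
  moreover have "v \<in> lists (UNIV \<times> carrier G)" "w \<in> lists (UNIV \<times> carrier G)"
    using vw(1,2) assms(1) lists_UNIV_Times_mono by blast+
  ultimately show ?case
    by (intro bexI[of _ "v @ w"]) (auto simp: word_value_append)
qed

section \<open>Word length for a finite generating set: triangle inequality, symmetry, finite
  balls\<close>

lemma word_length_le:
  "w \<in> lists (UNIV \<times> S) \<Longrightarrow> word_length G S (word_value G w) \<le> length w"
  unfolding word_length_def by (rule Least_le) blast

lemma word_length_word:
  assumes "finite_generating_set G S" "g \<in> carrier G"
  obtains w where "w \<in> lists (UNIV \<times> S)" "length w = word_length G S g" "word_value G w = g"
proof -
  have "\<exists>n. \<exists>w\<in>lists (UNIV \<times> S). length w = n \<and> word_value G w = g"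
    using generate_imp_word[of S g] assms unfolding finite_generating_set_def by auto
  from LeastI_ex[OF this] show thesis
    using that unfolding word_length_def by blast
qed

lemma word_length_mult:
  assumes "finite_generating_set G S" "g \<in> carrier G" "h \<in> carrier G"
  shows "word_length G S (g \<otimes> h) \<le> word_length G S g + word_length G S h"
proof -
  obtain v where v: "v \<in> lists (UNIV \<times> S)" "length v = word_length G S g" "word_value G v = g"
    using word_length_word assms(1,2) .
  obtain w where w: "w \<in> lists (UNIV \<times> S)" "length w = word_length G S h" "word_value G w = h"
    using word_length_word assms(1,3) .
  have "v \<in> lists (UNIV \<times> carrier G)" "w \<in> lists (UNIV \<times> carrier G)"
    using v(1) w(1) assms(1) lists_UNIV_Times_mono unfolding finite_generating_set_def by blast+
  then show ?thesis
    using word_length_le[of "v @ w" S] v w by (simp add: word_value_append)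
qed

lemma word_length_inv:
  assumes "finite_generating_set G S" "g \<in> carrier G"
  shows "word_length G S (inv g) = word_length G S g"
proof -
  have *: "word_length G S (inv h) \<le> word_length G S h" if "h \<in> carrier G" for h
  proof -
    obtain w where w: "w \<in> lists (UNIV \<times> S)" "length w = word_length G S h" "word_value G w = h"
      using word_length_word assms(1) \<open>h \<in> carrier G\<close> .
    have "w \<in> lists (UNIV \<times> carrier G)"
      using w(1) assms(1) lists_UNIV_Times_mono unfolding finite_generating_set_def by blast
    moreover have "rev (map (apfst Not) w) \<in> lists (UNIV \<times> S)"
      using w(1) by (rule formal_inverse_in_lists)
    ultimately show ?thesis
      using word_length_le[of "rev (map (apfst Not) w)" S] w by (simp add: word_value_inverse)
  qed
  show ?thesis
    using *[of g] *[of "inv g"] assms(2) by simp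
qed

lemma finite_word_length_le:
  assumes "finite_generating_set G S"
  shows "finite {g \<in> carrier G. word_length G S g \<le> n}"
proof (rule finite_subset)
  show "{g \<in> carrier G. word_length G S g \<le> n}
    \<subseteq> word_value G ` {w. set w \<subseteq> UNIV \<times> S \<and> length w \<le> n}"
  proof safe
    fix g assume "g \<in> carrier G" and n: "word_length G S g \<le> n"
    then obtain w where "w \<in> lists (UNIV \<times> S)" "length w = word_length G S g" "word_value G w = g"
      using word_length_word assms by metis
    then show "g \<in> word_value G ` {w. set w \<subseteq> UNIV \<times> S \<and> length w \<le> n}"
      using n by (intro image_eqI[of _ _ w]) auto
  qed
  show "finite (word_value G ` {w. set w \<subseteq> UNIV \<times> S \<and> length w \<le> n})"
    using assms unfolding finite_generating_set_def
    by (intro finite_imageI finite_lists_length_le) auto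
qed

text \<open>
  Along a geodesic from \<open>1\<close> to \<open>g\<close>, the prefixes \<open>x\<close> conjugate \<open>c\<close> into a fixed ball, by the
  four-point condition for \<open>1, g, x, cx\<close>. If \<open>g\<close> is long, two prefixes give the same conjugate,
  and the part of \<open>g\<close> between them can be split off as a short element centralizing \<open>c\<close>.
\<close>

lemma hyperbolic_centralizer_finitely_generated:
  assumes gen: "finite_generating_set G S"
    and hyp: "gromov_hyperbolic (carrier G) (word_dist G S) \<delta>"
    and c: "c \<in> carrier G"
  shows "\<exists>Y. finite Y \<and> (\<forall>x\<in>Y. x \<in> carrier G \<and> x \<otimes> c = c \<otimes> x) \<and>
           (\<forall>g\<in>carrier G. g \<otimes> c = c \<otimes> g \<longrightarrow> g \<in> generate G Y)"
proof -
  let ?L = "word_length G S"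
  \<comment> \<open>In \<open>near\<close> the four-point condition bounds the conjugate of
    \<open>c\<close> by \<open>?L c + 2 * \<delta>\<close>, whichever term of the minimum is the
    smaller one; \<open>R\<close> rounds this up to a natural number.\<close>
  define R where "R = nat \<lceil>?L c + 2 * \<delta>\<rceil>"
  define N where "N = card {g \<in> carrier G. ?L g \<le> R}"
  \<comment> \<open>\<open>N\<close> counts the possible conjugates, so two of the
    \<open>N + 1\<close> prefixes of length at most \<open>N\<close> share one. The radius
    \<open>2 * N\<close> leaves room for the product of one such prefix with the inverse of
    another.\<close>
  define Y where "Y = {x \<in> carrier G. x \<otimes> c = c \<otimes> x \<and> ?L x \<le> 2 * N}"
  have S: "S \<subseteq> carrier G"
    using gen unfolding finite_generating_set_def by simp
  have near: "?L (inv x \<otimes> c \<otimes> x) \<le> R"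
    if g: "g \<in> carrier G" "g \<otimes> c = c \<otimes> g" and x: "x \<in> carrier G"
      and geod: "?L x + ?L (inv x \<otimes> g) \<le> ?L g" for g x
  proof -
    let ?gp = "gromov_product (word_dist G S)"
    have "?gp \<one> x (c \<otimes> x) \<ge> min (?gp \<one> x g) (?gp \<one> g (c \<otimes> x)) - \<delta>"
      using hyp x c g unfolding gromov_hyperbolic_def by simp
    \<comment> \<open>Since \<open>g\<close> commutes with \<open>c\<close>, the distance from
      \<open>g\<close> to \<open>c \<otimes> x\<close> exceeds the distance from \<open>g\<close> to
      \<open>x\<close> by at most \<open>?L c\<close>.\<close>
    moreover have "inv g \<otimes> (c \<otimes> x) = c \<otimes> (inv g \<otimes> x)"
      using g c x commutes_inv[of g c] by (simp flip: m_assoc)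
    then have "?L (inv g \<otimes> (c \<otimes> x)) \<le> ?L c + ?L (inv x \<otimes> g)"
      using word_length_mult[OF gen, of c "inv g \<otimes> x"]
        word_length_inv[OF gen, of "inv x \<otimes> g"] c g x
      by (simp add: inv_mult_group)
    moreover have "?L (c \<otimes> x) \<le> ?L c + ?L x"
      using word_length_mult[OF gen] c x by simp
    moreover have "inv x \<otimes> (c \<otimes> x) = inv x \<otimes> c \<otimes> x"
      using c x by (simp add: m_assoc)
    ultimately have "?L (inv x \<otimes> c \<otimes> x) \<le> ?L c + 2 * \<delta>"
      using geod c g x unfolding gromov_product_def word_dist_def min_def
      by (simp split: if_splits add: diff_divide_distrib add_divide_distrib)
    then show ?thesis
      unfolding R_def by linarith
  qed
  have main: "g \<in> generate G Y" if "g \<in> carrier G" "g \<otimes> c = c \<otimes> g" for g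
    using that
  proof (induction "?L g" arbitrary: g rule: less_induct)
    case less
    note g = less.prems
    show ?case
    proof (cases "?L g \<le> N")
      case True
      then show ?thesis
        using g unfolding Y_def by (intro generate.incl) auto
    next
      case False
      obtain w where w: "w \<in> lists (UNIV \<times> S)" "length w = ?L g" "word_value G w = g"
        using word_length_word gen g(1) .
      define x where "x k = word_value G (take k w)" for k
      define y where "y k = word_value G (drop k w)" for k
      have tw: "take k w \<in> lists (UNIV \<times> S)" "drop k w \<in> lists (UNIV \<times> S)" for k
        using w(1) by (auto dest: in_set_takeD in_set_dropD)
      have tw': "take k w \<in> lists (UNIV \<times> carrier G)" "drop k w \<in> lists (UNIV \<times> carrier G)" for k
        using tw[of k] S lists_UNIV_Times_mono by blast+
      have x: "x k \<in> carrier G" and y: "y k \<in> carrier G" for k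
        unfolding x_def y_def using tw' by simp_all
      have xy: "x k \<otimes> y k = g" for k
        unfolding x_def y_def by (simp add: word_value_append[symmetric] tw' w(3))
      have invx: "inv (x k) \<otimes> g = y k" for k
        using xy[of k, symmetric] x y by simp
      have Lx: "?L (x k) \<le> k" if "k \<le> ?L g" for k
        using word_length_le[OF tw(1)[of k]] that w(2) unfolding x_def by simp
      have Ly: "?L (y k) \<le> ?L g - k" for k
        using word_length_le[OF tw(2)[of k]] w(2) unfolding y_def by simp
      define f where "f k = inv (x k) \<otimes> c \<otimes> x k" for k
      \<comment> \<open>Pigeonhole: \<open>near\<close> puts all \<open>N + 1\<close> values of
        \<open>f\<close> into a ball with \<open>N\<close> elements. As \<open>N < ?L g\<close>,
        every index up to \<open>N\<close> is a position on the geodesic word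
        \<open>w\<close>.\<close>
      have "\<not> inj_on f {..N}"
      proof
        assume "inj_on f {..N}"
        moreover have "f ` {..N} \<subseteq> {g \<in> carrier G. ?L g \<le> R}"
        proof safe
          fix k assume "k \<le> N"
          then have "k \<le> ?L g"
            using False by simp
          then have "?L (x k) + ?L (inv (x k) \<otimes> g) \<le> ?L g"
            using Lx[of k] Ly[of k] by (simp add: invx)
          then show "?L (f k) \<le> R"
            unfolding f_def by (rule near[OF g x])
        qed (use x c in \<open>simp add: f_def\<close>)
        ultimately have "card {..N} \<le> card {g \<in> carrier G. ?L g \<le> R}"
          using card_inj_on_le finite_word_length_le[OF gen] by blast
        then show False
          by (simp add: N_def)
      qed
      then obtain i j where ij: "i < j" "j \<le> N" "f i = f j"
        unfolding inj_on_def by (metis atMost_iff linorder_neqE_nat)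
      \<comment> \<open>The prefixes \<open>x i\<close> and \<open>x j\<close> conjugate
        \<open>c\<close> to the same element, so this quotient centralizes \<open>c\<close>.\<close>
      define e where "e = x j \<otimes> inv (x i)"
      have e: "e \<in> carrier G"
        using x by (simp add: e_def)
      have "e \<otimes> c = x j \<otimes> f i \<otimes> inv (x i)"
        using x c unfolding e_def f_def by (simp add: m_assoc)
      also have "\<dots> = x j \<otimes> f j \<otimes> inv (x i)"
        by (simp add: ij(3))
      also have "\<dots> = c \<otimes> e"
        using x c unfolding e_def f_def by (simp add: m_assoc)
      finally have ec: "e \<otimes> c = c \<otimes> e" .
      have "?L e \<le> j + i"
        using word_length_mult[OF gen, of "x j" "inv (x i)"] word_length_inv[OF gen, of "x i"]
          Lx[of i] Lx[of j] ij False x unfolding e_def by fastforce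
      then have eY: "e \<in> Y"
        using ij e ec unfolding Y_def by simp
      \<comment> \<open>Cutting the letters between positions \<open>i\<close> and \<open>j\<close>
        out of \<open>w\<close> leaves a word for \<open>h\<close>, which is therefore shorter than
        \<open>g\<close>, and \<open>g = e \<otimes> h\<close>.\<close>
      define h where "h = x i \<otimes> y j"
      have h: "h \<in> carrier G" "g = e \<otimes> h"
        using x y xy[of j] unfolding h_def e_def by (simp_all add: m_assoc)
      then have "h = inv e \<otimes> g"
        using e by simp
      then have "h \<otimes> c = inv e \<otimes> c \<otimes> g"
        using g e c by (simp add: m_assoc)
      also have "\<dots> = c \<otimes> h"
        using \<open>h = inv e \<otimes> g\<close> commutes_inv[OF e c ec] g e c by (simp add: m_assoc)
      finally have "h \<otimes> c = c \<otimes> h" .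
      moreover have "?L h < ?L g"
        using word_length_mult[OF gen, of "x i" "y j"] Lx[of i] Ly[of j] ij False x y
        unfolding h_def by fastforce
      ultimately have "h \<in> generate G Y"
        using less.hyps h(1) by blast
      then show ?thesis
        using eY h(2) by (auto intro: generate.intros)
    qed
  qed
  have "finite Y"
    unfolding Y_def by (rule finite_subset[OF _ finite_word_length_le[OF gen]]) auto
  then show ?thesis
    using main unfolding Y_def by (intro exI[of _ Y]) (auto simp: Y_def)
qed

end

section \<open>Common roots in 2-free groups\<close>

definition infinite_order :: "('a, 'm) monoid_scheme \<Rightarrow> 'a \<Rightarrow> bool" where
  "infinite_order G r \<longleftrightarrow>
     r \<in> carrier G \<and> (\<forall>k::int. r [^]\<^bsub>G\<^esub> k = \<one>\<^bsub>G\<^esub> \<longrightarrow> k = 0)"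

context group
begin

lemma subgroup_centralizer:
  assumes "c \<in> carrier G"
  shows "subgroup {g \<in> carrier G. g \<otimes> c = c \<otimes> g} G"
proof (rule subgroupI)
  fix a b assume "a \<in> {g \<in> carrier G. g \<otimes> c = c \<otimes> g}" "b \<in> {g \<in> carrier G. g \<otimes> c = c \<otimes> g}"
  then have a: "a \<in> carrier G" "a \<otimes> c = c \<otimes> a" and b: "b \<in> carrier G" "b \<otimes> c = c \<otimes> b"
    by auto
  have "a \<otimes> b \<otimes> c = a \<otimes> c \<otimes> b"
    using a(1) b assms by (simp add: m_assoc)
  then show "a \<otimes> b \<in> {g \<in> carrier G. g \<otimes> c = c \<otimes> g}"
    using a b(1) assms by (simp add: m_assoc)
qed (use assms commutes_inv in auto)

lemma centralizes_generate:
  assumes "c \<in> carrier G" "Y \<subseteq> {g \<in> carrier G. g \<otimes> c = c \<otimes> g}" "g \<in> generate G Y"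
  shows "g \<otimes> c = c \<otimes> g"
  using generate_subgroup_incl[OF assms(2) subgroup_centralizer] assms(1,3) by blast

text \<open>
  If \<open>w\<close> represents \<open>c\<close> and the basis has two elements, some letter \<open>m\<close> cancels at neither end
  of \<open>w\<close> and differs from its first letter, so the reduced words \<open>m w\<close> and \<open>w m\<close> are distinct.
\<close>

lemma free_basis_center:
  assumes free: "free_basis G B" and c: "c \<in> carrier G" "c \<noteq> \<one>"
    and central: "\<And>g. g \<in> carrier G \<Longrightarrow> g \<otimes> c = c \<otimes> g"
  shows "\<exists>b. B = {b}"
proof -
  have B: "B \<subseteq> carrier G"
    and inj: "inj_on (word_value G) {w \<in> lists (UNIV \<times> B). reduced_word w}"
    and surj: "word_value G ` {w \<in> lists (UNIV \<times> B). reduced_word w} = carrier G"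
    using free unfolding free_basis_def bij_betw_def by auto
  obtain w where w: "w \<in> lists (UNIV \<times> B)" "reduced_word w" "word_value G w = c"
    using surj c(1) by (smt (verit) imageE mem_Collect_eq)
  have w': "w \<in> lists (UNIV \<times> carrier G)"
    using w(1) B by (rule lists_UNIV_Times_mono)
  have "w \<noteq> []"
    using w(3) c(2) by auto
  then have hd: "snd (hd w) \<in> B" and last: "snd (last w) \<in> B"
    using w(1) hd_in_set[of w] last_in_set[of w] by (auto simp: mem_Times_iff)
  have "y = snd (hd w)" if "y \<in> B" for y
  proof (rule ccontr)
    assume neq: "y \<noteq> snd (hd w)"
    \<comment> \<open>If \<open>w\<close> ends in the basis element it starts with, a letter on the
      other basis element \<open>y\<close> cancels at neither end. Otherwise repeating the last
      letter of \<open>w\<close> cannot cancel at the end, and it lies over a different basis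
      element than the first letter.\<close>
    define m where "m = (if snd (last w) = snd (hd w) then (True, y) else last w)"
    have m: "snd m \<in> B" "snd m \<noteq> snd (hd w)" "snd m = snd (last w) \<longrightarrow> m = last w"
      using last \<open>y \<in> B\<close> neq unfolding m_def by (auto split: if_splits)
    have "word_value G (m # w) = word_value G (w @ [m])"
      using w(3) w' m(1) B central[of "letter_value G m"]
      by (subst word_value_append) (auto simp: c(1) subsetD mem_Times_iff)
    moreover have "reduced_word (m # w)" "reduced_word (w @ [m])"
      using w(2) \<open>w \<noteq> []\<close> m unfolding reduced_word_def
      by (cases m; cases "hd w"; cases "last w";
          auto simp: successively_Cons successively_append_iff)+
    moreover have "m # w \<in> lists (UNIV \<times> B)" "w @ [m] \<in> lists (UNIV \<times> B)"
      using w(1) m(1) by (auto simp: mem_Times_iff)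
    ultimately have "m # w = w @ [m]"
      using inj_onD[OF inj] by blast
    then have "hd (m # w) = hd (w @ [m])"
      by (rule arg_cong)
    then show False
      using m(2) \<open>w \<noteq> []\<close> by simp
  qed
  then show ?thesis
    using hd by blast
qed

lemma word_value_replicate:
  "x \<in> carrier G \<Longrightarrow> word_value G (replicate n (True, x)) = x [^] n"
  by (induction n) (simp, simp, metis nat_pow_Suc nat_pow_Suc2)

text \<open>A group free on one element is infinite cyclic; this is the form in which the basis
  found by \<open>free_basis_center\<close> is used.\<close>

lemma free_basis_singleton:
  assumes free: "free_basis G {b}"
  shows "b \<in> carrier G" "g \<in> carrier G \<Longrightarrow> \<exists>k::int. g = b [^] k"
    "b [^] (k::int) = \<one> \<Longrightarrow> k = 0"
proof -
  show b: "b \<in> carrier G"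
    using free unfolding free_basis_def by simp
  have inj: "inj_on (word_value G) {w \<in> lists (UNIV \<times> {b}). reduced_word w}"
    and surj: "word_value G ` {w \<in> lists (UNIV \<times> {b}). reduced_word w} = carrier G"
    using free unfolding free_basis_def bij_betw_def by auto
  show "\<exists>k::int. g = b [^] k" if "g \<in> carrier G"
  proof -
    obtain w where "w \<in> lists (UNIV \<times> {b})" "word_value G w = g"
      using surj \<open>g \<in> carrier G\<close> by (smt (verit) imageE mem_Collect_eq)
    then have "g \<in> generate G {b}"
      using word_value_in_generate[of "{b}" w] b by simp
    then show ?thesis
      using generate_pow[OF b] by auto
  qed
  \<comment> \<open>The word repeating \<open>(True, b)\<close> is reduced and would have the same
    value as the empty word, against uniqueness of reduced words.\<close>
  have *: "n = 0" if "b [^] n = \<one>" for n :: nat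
  proof -
    have "successively (\<lambda>(a, x) (b, y). \<not> (x = y \<and> a \<noteq> b)) (replicate n (True, b))"
      by (induction n) (auto simp: successively_Cons)
    then have "replicate n (True, b) = []"
      using that b by (intro inj_onD[OF inj]) (auto simp: word_value_replicate reduced_word_def)
    then show ?thesis
      by simp
  qed
  show "k = 0" if "b [^] k = \<one>"
  proof (cases k rule: int_cases2)
    case (nonneg n)
    then show ?thesis
      using that *[of n] by (simp add: int_pow_int)
  next
    case (nonpos n)
    then show ?thesis
      using that *[of n] b by (simp add: int_pow_neg_int)
  qed
qed

text \<open>The subgroup generated by \<open>a\<close> and \<open>b\<close> is free and has the
  non-trivial central element \<open>c\<close>, so it is infinite cyclic; its generator is the
  common root.\<close>

lemma two_free_common_root:
  assumes "two_free G" and a: "a \<in> carrier G" and b: "b \<in> carrier G"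
    and c: "c \<in> generate G {a, b}" "c \<noteq> \<one>" "a \<otimes> c = c \<otimes> a" "b \<otimes> c = c \<otimes> b"
  obtains r j k where "infinite_order G r" "a = r [^] (j::int)" "b = r [^] (k::int)"
proof -
  let ?H = "subgroup_generated G {a, b}"
  have H: "carrier ?H = generate G {a, b}"
    using a b by (simp add: carrier_subgroup_generated)
  have cG: "c \<in> carrier G"
    using generate_in_carrier[OF _ c(1)] a b by blast
  interpret H: group ?H
    by simp
  obtain B where B: "free_basis ?H B"
    using assms(1) a b unfolding two_free_def free_group_def by blast
  have "g \<otimes>\<^bsub>?H\<^esub> c = c \<otimes>\<^bsub>?H\<^esub> g" if "g \<in> carrier ?H" for g
    using centralizes_generate[OF cG, of "{a, b}" g] that c a b by (simp add: H)
  then obtain r where "B = {r}"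
    using H.free_basis_center[OF B, of c] c by (auto simp: H)
  then have r: "free_basis ?H {r}"
    using B by simp
  have rH: "r \<in> carrier ?H"
    using H.free_basis_singleton(1)[OF r] .
  have pow: "r [^]\<^bsub>?H\<^esub> (k::int) = r [^] k" for k
    using rH int_pow_subgroup_generated by blast
  have "r \<in> carrier G"
    using rH carrier_subgroup_generated_subset by blast
  moreover have "a \<in> carrier ?H" "b \<in> carrier ?H"
    by (auto simp: H intro: generate.incl)
  ultimately show thesis
    using that[of r] H.free_basis_singleton(2,3)[OF r] unfolding infinite_order_def
    by (metis pow one_subgroup_generated)
qed

text \<open>Finitely many elements generate the centralizer of \<open>c\<close>. Absorbing them one
  at a time into a common root by \<open>two_free_common_root\<close> stops after finitely many
  steps.\<close>

lemma hyperbolic_centralizer_cyclic: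
  assumes free: "two_free G" and hyp: "word_hyperbolic G"
    and c: "c \<in> carrier G" "c \<noteq> \<one>"
  obtains r where "infinite_order G r"
    "\<And>g. g \<in> carrier G \<Longrightarrow> g \<otimes> c = c \<otimes> g \<longleftrightarrow> (\<exists>k::int. g = r [^] k)"
proof -
  obtain Y where "finite Y" and Y: "\<forall>x\<in>Y. x \<in> carrier G \<and> x \<otimes> c = c \<otimes> x"
    and gen: "\<forall>g\<in>carrier G. g \<otimes> c = c \<otimes> g \<longrightarrow> g \<in> generate G Y"
    using hyp hyperbolic_centralizer_finitely_generated[OF _ _ c(1)]
    unfolding word_hyperbolic_def by metis
  \<comment> \<open>Keeping \<open>c\<close> among the powers of \<open>r\<close> makes
    \<open>c\<close> an element of the subgroup generated by \<open>r\<close> and the next generator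
    \<open>a\<close>, central there, as \<open>two_free_common_root\<close> requires.\<close>
  have "\<exists>r. infinite_order G r \<and> (\<forall>x\<in>insert c Y. \<exists>k::int. x = r [^] k)"
    using \<open>finite Y\<close> Y
  proof (induction Y)
    case empty
    obtain r k where "infinite_order G r" "c = r [^] (k::int)"
      using two_free_common_root[OF free c(1) c(1) _ c(2)] generate.incl[of c "{c, c}" G] by blast
    then show ?case
      by blast
  next
    case (insert a Y)
    then obtain r where r: "infinite_order G r" and "\<forall>x\<in>insert c Y. \<exists>k::int. x = r [^] k"
      by auto
    then obtain k where k: "c = r [^] (k::int)" and Y: "\<forall>x\<in>Y. \<exists>k::int. x = r [^] k"
      by auto
    have rG: "r \<in> carrier G"
      using r unfolding infinite_order_def by simp
    have a: "a \<in> carrier G" "a \<otimes> c = c \<otimes> a"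
      using insert.prems by auto
    have "c \<in> generate G {r}"
      using generate_pow[OF rG] k by auto
    then have "c \<in> generate G {r, a}"
      using mono_generate[of "{r}" "{r, a}"] by blast
    moreover have "r \<otimes> c = c \<otimes> r"
      using k rG int_pow_mult[OF rG, of 1 k] int_pow_mult[OF rG, of k 1] by (simp add: add.commute)
    ultimately obtain s i j where s: "infinite_order G s" "r = s [^] (i::int)" "a = s [^] (j::int)"
      using two_free_common_root[OF free rG a(1) _ c(2)] a(2) by blast
    then have "s \<in> carrier G"
      unfolding infinite_order_def by simp
    \<comment> \<open>The new root \<open>s\<close> is also a root of everything that
      \<open>r\<close> was a root of.\<close>
    then have "r [^] (l::int) = s [^] (i * l)" for l
      using s(2) by (simp add: int_pow_pow)
    then show ?case
      using s k Y by (metis insert_iff)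
  qed
  then obtain r where r: "infinite_order G r" and root: "\<forall>x\<in>insert c Y. \<exists>k::int. x = r [^] k"
    by blast
  have rG: "r \<in> carrier G"
    using r unfolding infinite_order_def by simp
  have "generate G Y \<subseteq> generate G {r}"
    using root generate_pow[OF rG] rG
    by (intro generate_subgroup_incl generate_is_subgroup) auto
  moreover obtain k where k: "c = r [^] (k::int)"
    using root by auto
  have "r [^] l \<otimes> c = c \<otimes> r [^] l" for l :: int
    using rG by (simp add: k int_pow_mult[symmetric] add.commute)
  ultimately show thesis
    using that[OF r] gen generate_pow[OF rG] by blast
qed

end

section \<open>Polynomial growth\<close>

context group
begin

text \<open>For \<open>r\<close> of infinite order this is the normalizer of the cyclic subgroup
  generated by \<open>r\<close>; for trivial \<open>r\<close> it is the whole group.\<close>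

definition inverters :: "'a \<Rightarrow> 'a set" where
  "inverters r = {x \<in> carrier G. r \<otimes> x = x \<otimes> r \<or> r \<otimes> x = x \<otimes> inv r}"

text \<open>A power of \<open>r\<close> can be moved past \<open>x\<close> at the cost of a sign
  only. That the absolute value of the exponent survives is what keeps the later exponent bounds
  quadratic.\<close>

lemma inverters_int_pow:
  assumes "r \<in> carrier G" "x \<in> inverters r"
  obtains j :: int where "\<bar>j\<bar> = \<bar>k\<bar>" "r [^] k \<otimes> x = x \<otimes> r [^] j"
proof -
  have x: "x \<in> carrier G"
    using assms(2) unfolding inverters_def by simp
  have conj_pow: "r [^] k \<otimes> x = x \<otimes> s [^] k" if "s \<in> carrier G" "r \<otimes> x = x \<otimes> s" for s
  proof -
    have nat: "r [^] n \<otimes> x = x \<otimes> s [^] n" for n :: nat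
    proof (induction n)
      case (Suc n)
      have "r [^] Suc n \<otimes> x = r [^] n \<otimes> x \<otimes> s"
        using assms(1) x that by (simp add: m_assoc)
      then show ?case
        using Suc assms(1) x that(1) by (simp add: m_assoc)
    qed (use x in simp)
    have inv: "inv (r [^] n) \<otimes> x = x \<otimes> inv (s [^] n)" for n :: nat
    proof -
      have "inv (r [^] n) \<otimes> x = inv (r [^] n) \<otimes> (x \<otimes> s [^] n) \<otimes> inv (s [^] n)"
        using assms(1) x that(1) by (simp add: m_assoc)
      also have "\<dots> = x \<otimes> inv (s [^] n)"
        using assms(1) x that(1) by (simp flip: nat)
      finally show ?thesis .
    qed
    show ?thesis
    proof (cases k rule: int_cases2)
      case (nonneg n)
      then show ?thesis
        using nat[of n] by (simp only: int_pow_int)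
    next
      case (nonpos n)
      then show ?thesis
        using inv[of n] by (simp only: int_pow_neg_int assms(1) that(1))
    qed
  qed
  consider "r \<otimes> x = x \<otimes> r" | "r \<otimes> x = x \<otimes> inv r"
    using assms(2) unfolding inverters_def by blast
  then show thesis
  proof cases
    case 1
    then show thesis
      using conj_pow[OF assms(1)] by (intro that[of k]) simp_all
  next
    case 2
    then show thesis
      using conj_pow[of "inv r"] assms(1)
      by (intro that[of "- k"]) (simp_all add: int_pow_inv int_pow_neg)
  qed
qed

text \<open>These are the elements whose conjugation permutes the set of \<open>r\<close> and
  \<open>inv r\<close>; the element \<open>s\<close> records the sign contributed by
  \<open>a\<close>.\<close>

lemma subgroup_inverters:
  assumes r: "r \<in> carrier G"
  shows "subgroup (inverters r) G"
proof (rule subgroupI)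
  show "inverters r \<noteq> {}"
    using r by (auto simp: inverters_def intro!: exI[of _ \<one>])
  fix a assume a: "a \<in> inverters r"
  then have aG: "a \<in> carrier G"
    unfolding inverters_def by simp
  obtain s where s: "s = r \<or> s = inv r" "r \<otimes> a = a \<otimes> s"
    using a unfolding inverters_def by blast
  have sG: "s \<in> carrier G"
    using s(1) r by auto
  have "s \<otimes> inv a = inv a \<otimes> (a \<otimes> s) \<otimes> inv a"
    using sG aG by (simp add: m_assoc)
  also have "\<dots> = inv a \<otimes> r"
    using r aG by (simp add: m_assoc flip: s(2))
  finally have *: "s \<otimes> inv a = inv a \<otimes> r" .
  have "r \<otimes> inv a = inv a \<otimes> s"
    using s(1)
  proof
    assume "s = inv r"
    then have "r \<otimes> inv a = r \<otimes> (inv a \<otimes> r) \<otimes> inv r"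
      using r aG by (simp add: m_assoc)
    also have "\<dots> = inv a \<otimes> s"
      using r aG \<open>s = inv r\<close> by (simp flip: *)
    finally show ?thesis .
  qed (use * in simp)
  then show "inv a \<in> inverters r"
    using s(1) aG unfolding inverters_def by auto
  fix b assume b: "b \<in> inverters r"
  then have bG: "b \<in> carrier G"
    unfolding inverters_def by simp
  have "s \<otimes> b = b \<otimes> r \<or> s \<otimes> b = b \<otimes> inv r"
    using s(1)
  proof
    assume "s = inv r"
    moreover obtain j :: int where "\<bar>j\<bar> = \<bar>- 1\<bar>" "r [^] (- 1 :: int) \<otimes> b = b \<otimes> r [^] j"
      using inverters_int_pow[OF r b] .
    moreover from this have "j = 1 \<or> j = - 1"
      by arith
    ultimately show ?thesis
      using r int_pow_neg[OF r, of 1] by auto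
  qed (use b in \<open>simp add: inverters_def\<close>)
  then have "a \<otimes> (s \<otimes> b) = a \<otimes> b \<otimes> r \<or> a \<otimes> (s \<otimes> b) = a \<otimes> b \<otimes> inv r"
    using aG bG r by (auto simp: m_assoc)
  moreover have "r \<otimes> (a \<otimes> b) = a \<otimes> (s \<otimes> b)"
    using aG bG r sG s(2) by (simp flip: m_assoc)
  ultimately show "a \<otimes> b \<in> inverters r"
    using aG bG unfolding inverters_def by auto
qed (auto simp: inverters_def)

text \<open>
  Rearranging a word of length \<open>n\<close> takes at most \<open>n\<^sup>2\<close> transpositions of adjacent letters; each
  costs a power of \<open>r\<close> with bounded exponent, and moving it to the end of the word only changes
  its sign.
\<close>

lemma word_value_permute:
  assumes r: "r \<in> carrier G" and S: "S \<subseteq> inverters r"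
    and comm: "\<And>l m. l \<in> UNIV \<times> S \<Longrightarrow> m \<in> UNIV \<times> S \<Longrightarrow> \<exists>j::int. \<bar>j\<bar> \<le> int M \<and>
      letter_value G l \<otimes> letter_value G m = letter_value G m \<otimes> letter_value G l \<otimes> r [^] j"
    and w: "w \<in> lists (UNIV \<times> S)" and w': "w' \<in> lists (UNIV \<times> S)" and mset: "mset w = mset w'"
  shows "\<exists>j::int. \<bar>j\<bar> \<le> int (M * (length w)\<^sup>2) \<and> word_value G w = word_value G w' \<otimes> r [^] j"
proof -
  have SG: "S \<subseteq> carrier G"
    using S unfolding inverters_def by auto
  have wv: "word_value G v \<in> carrier G" "word_value G v \<in> inverters r"
    if "v \<in> lists (UNIV \<times> S)" for v
    using word_value_in_generate[OF SG that] generate_subgroup_incl[OF S subgroup_inverters[OF r]]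
    by (auto simp: inverters_def)
  have lv: "letter_value G l \<in> carrier G" "letter_value G l \<in> inverters r"
    if "l \<in> UNIV \<times> S" for l
    using wv[of "[l]"] that SG by (auto simp: subset_iff)
  \<comment> \<open>Passing \<open>l\<close> over each letter of \<open>a\<close> creates a power of
    \<open>r\<close> with exponent at most \<open>M\<close> in absolute value. Moving that power to
    the right end changes only its sign, so the total is linear in \<open>length a\<close>.\<close>
  have move: "\<exists>j::int. \<bar>j\<bar> \<le> int (M * length a) \<and>
      letter_value G l \<otimes> word_value G a = word_value G a \<otimes> letter_value G l \<otimes> r [^] j"
    if l: "l \<in> UNIV \<times> S" and "a \<in> lists (UNIV \<times> S)" for l a
    using that(2)
  proof (induction a)
    case Nil
    show ?case
      using lv[OF l] by (intro exI[of _ 0]) simp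
  next
    case (Cons m a)
    note lG = lv(1)[OF l] and mG = lv(1)[OF Cons.hyps(1)] and aG = wv(1)[OF Cons.hyps(2)]
    obtain i :: int where i: "\<bar>i\<bar> \<le> int M"
      "letter_value G l \<otimes> letter_value G m = letter_value G m \<otimes> letter_value G l \<otimes> r [^] i"
      using comm[OF l Cons.hyps(1)] by blast
    obtain i' :: int where i': "\<bar>i'\<bar> = \<bar>i\<bar>" "r [^] i \<otimes> word_value G a = word_value G a \<otimes> r [^] i'"
      using inverters_int_pow[OF r wv(2)[OF Cons.hyps(2)]] .
    obtain j :: int where j: "\<bar>j\<bar> \<le> int (M * length a)"
      "letter_value G l \<otimes> word_value G a = word_value G a \<otimes> letter_value G l \<otimes> r [^] j"
      using Cons.IH by blast
    have "letter_value G l \<otimes> (letter_value G m \<otimes> word_value G a)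
        = letter_value G m \<otimes> letter_value G l \<otimes> (r [^] i \<otimes> word_value G a)"
      using lG mG aG r i(2) by (simp flip: m_assoc)
    also have "\<dots> = letter_value G m \<otimes> (letter_value G l \<otimes> word_value G a) \<otimes> r [^] i'"
      using lG mG aG r i'(2) by (simp add: m_assoc)
    also have "\<dots> = letter_value G m \<otimes> word_value G a \<otimes> letter_value G l \<otimes> r [^] (j + i')"
      using lG mG aG r j(2) by (simp add: m_assoc int_pow_mult)
    finally show ?case
      using i(1) i'(1) j(1) by (intro exI[of _ "j + i'"]) (auto simp: algebra_simps)
  qed
  show ?thesis
    using w w' mset
  proof (induction w arbitrary: w')
    case Nil
    then show ?case
      by (intro exI[of _ 0]) simp
  next
    case (Cons l v)
    \<comment> \<open>The first letter \<open>l\<close> of the word is located in \<open>w'\<close>.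
      The induction hypothesis compares the remaining letters \<open>v\<close> with
      \<open>a @ b\<close>, and \<open>move\<close> then carries \<open>l\<close> past
      \<open>a\<close> into its place.\<close>
    obtain a b where w': "w' = a @ l # b"
      using Cons.prems(2) by (metis list.set_intros(1) set_mset_mset split_list)
    have l: "l \<in> UNIV \<times> S" and a: "a \<in> lists (UNIV \<times> S)" and b: "b \<in> lists (UNIV \<times> S)"
      using Cons.prems(1) by (simp_all add: w')
    note lists = lists_UNIV_Times_mono[OF a SG] lists_UNIV_Times_mono[OF b SG]
    note lG = lv(1)[OF l] and aG = wv(1)[OF a] and bG = wv(1)[OF b]
    have lG': "snd l \<in> carrier G"
      using l SG by auto
    have len: "length a \<le> length v"
      using mset_eq_length[OF Cons.prems(2)] by (simp add: w')
    have "mset v = mset (a @ b)"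
      using Cons.prems(2) by (simp add: w')
    then obtain i :: int where i: "\<bar>i\<bar> \<le> int (M * (length v)\<^sup>2)"
      "word_value G v = word_value G (a @ b) \<otimes> r [^] i"
      using Cons.IH[of "a @ b"] a b by auto
    obtain j :: int where j: "\<bar>j\<bar> \<le> int (M * length a)"
      "letter_value G l \<otimes> word_value G a = word_value G a \<otimes> letter_value G l \<otimes> r [^] j"
      using move[OF l a] by blast
    obtain j' :: int where j': "\<bar>j'\<bar> = \<bar>j\<bar>" "r [^] j \<otimes> word_value G b = word_value G b \<otimes> r [^] j'"
      using inverters_int_pow[OF r wv(2)[OF b]] .
    have "word_value G (l # v) = letter_value G l \<otimes> word_value G a \<otimes> word_value G b \<otimes> r [^] i"
      using lG aG bG r by (simp add: i(2) word_value_append lists m_assoc)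
    also have "\<dots> = word_value G a \<otimes> letter_value G l \<otimes> (r [^] j \<otimes> word_value G b) \<otimes> r [^] i"
      using lG aG bG r by (simp add: j(2) m_assoc)
    also have "\<dots> = word_value G w' \<otimes> r [^] (j' + i)"
      using lG aG bG r lG' lists
      by (simp add: j'(2) w' word_value_append m_assoc int_pow_mult mem_Times_iff)
    finally have "word_value G (l # v) = word_value G w' \<otimes> r [^] (j' + i)" .
    \<comment> \<open>With \<open>n = length v\<close>, the bound follows from
      \<open>M * n + M * n^2 \<le> M * (n + 1)^2\<close>.\<close>
    moreover have "\<bar>j' + i\<bar> \<le> int (M * length v) + int (M * (length v)\<^sup>2)"
      using i(1) j(1) j'(1) mult_le_mono2[OF len, of M] by linarith
    then have "\<bar>j' + i\<bar> \<le> int (M * (length (l # v))\<^sup>2)"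
      by (rule order_trans) (simp add: power2_eq_square algebra_simps flip: of_nat_mult of_nat_add)
    ultimately show ?case
      by blast
  qed
qed

text \<open>By \<open>word_value_permute\<close> a value is determined by the letter counts, each at
  most \<open>n\<close>, and an exponent in an interval of length quadratic in \<open>n\<close>.
  Counting these data gives a polynomial.\<close>

lemma card_word_values_le:
  assumes r: "r \<in> carrier G" and S: "finite S" "S \<subseteq> inverters r"
    and comm: "\<And>l m. l \<in> UNIV \<times> S \<Longrightarrow> m \<in> UNIV \<times> S \<Longrightarrow> \<exists>j::int.
      letter_value G l \<otimes> letter_value G m = letter_value G m \<otimes> letter_value G l \<otimes> r [^] j"
  shows "\<exists>C d. \<forall>n. card {word_value G w |w. w \<in> lists (UNIV \<times> S) \<and> length w \<le> n}
    \<le> C * (n + 1) ^ d"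
proof -
  let ?L = "UNIV \<times> S :: (bool \<times> 'a) set"
  have L: "finite ?L"
    using S(1) by simp
  have "\<forall>q\<in>?L \<times> ?L. \<exists>j::int. letter_value G (fst q) \<otimes> letter_value G (snd q)
      = letter_value G (snd q) \<otimes> letter_value G (fst q) \<otimes> r [^] j"
    using comm by auto
  then obtain J :: "_ \<Rightarrow> int" where J: "\<forall>q\<in>?L \<times> ?L. letter_value G (fst q) \<otimes> letter_value G (snd q)
      = letter_value G (snd q) \<otimes> letter_value G (fst q) \<otimes> r [^] J q"
    by metis
  \<comment> \<open>There are finitely many pairs of letters, so the sum of their exponents in
    absolute value bounds each one uniformly.\<close>
  define M where "M = (\<Sum>q\<in>?L \<times> ?L. nat \<bar>J q\<bar>)"
  have comm': "\<exists>j::int. \<bar>j\<bar> \<le> int M \<and>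
      letter_value G l \<otimes> letter_value G m = letter_value G m \<otimes> letter_value G l \<otimes> r [^] j"
    if "l \<in> ?L" "m \<in> ?L" for l m
  proof (intro exI conjI)
    have lm: "(l, m) \<in> ?L \<times> ?L"
      using that by simp
    then have "nat \<bar>J (l, m)\<bar> \<le> M"
      unfolding M_def using L by (intro member_le_sum) auto
    then show "\<bar>J (l, m)\<bar> \<le> int M"
      by simp
    show "letter_value G l \<otimes> letter_value G m
        = letter_value G m \<otimes> letter_value G l \<otimes> r [^] J (l, m)"
      using bspec[OF J lm] by simp
  qed
  \<comment> \<open>A fixed word for each choice of letter counts, to which every word with these
    counts is rearranged.\<close>
  define rep where
    "rep f = (SOME w. w \<in> lists ?L \<and> (\<forall>l\<in>?L. count (mset w) l = f l))" for f :: "bool \<times> 'a \<Rightarrow> nat"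
  have card_interval: "card {- int K..int K} = 2 * K + 1" for K
    by simp
  have bound: "card {word_value G w |w. w \<in> lists ?L \<and> length w \<le> n}
      \<le> (2 * M + 1) * (n + 1) ^ (card ?L + 2)" for n
  proof -
    let ?P = "(?L \<rightarrow>\<^sub>E {..n}) \<times> {- int (M * n\<^sup>2)..int (M * n\<^sup>2)}"
    have "{word_value G w |w. w \<in> lists ?L \<and> length w \<le> n}
      \<subseteq> (\<lambda>(f, j). word_value G (rep f) \<otimes> r [^] j) ` ?P"
    proof
      fix g assume "g \<in> {word_value G w |w. w \<in> lists ?L \<and> length w \<le> n}"
      then obtain w where g: "g = word_value G w" and w: "w \<in> lists ?L" and n: "length w \<le> n"
        by blast
      \<comment> \<open>Restricting to the alphabet makes \<open>f\<close> extensional, so that it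
        belongs to the finite function space in \<open>?P\<close>.\<close>
      define f where "f = restrict (count (mset w)) ?L"
      have "w \<in> lists ?L \<and> (\<forall>l\<in>?L. count (mset w) l = f l)"
        using w by (simp add: f_def)
      then have rep: "rep f \<in> lists ?L \<and> (\<forall>l\<in>?L. count (mset (rep f)) l = f l)"
        unfolding rep_def by (rule someI)
      have "mset w = mset (rep f)"
      proof (rule multiset_eqI)
        fix l
        show "count (mset w) l = count (mset (rep f)) l"
        proof (cases "l \<in> ?L")
          case True
          then show ?thesis
            using bspec[OF conjunct2[OF rep] True] by (simp add: f_def)
        next
          case False
          then have "l \<notin> set w" "l \<notin> set (rep f)"
            using w rep by (metis in_listsD)+
          then show ?thesis
            by (metis count_mset_0_iff)
        qed
      qed
      then obtain j :: int where j: "\<bar>j\<bar> \<le> int (M * (length w)\<^sup>2)"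
        "word_value G w = word_value G (rep f) \<otimes> r [^] j"
        using word_value_permute[OF r S(2) comm' w, of "rep f"] rep by blast
      have "M * (length w)\<^sup>2 \<le> M * n\<^sup>2"
        using n by simp
      then have "\<bar>j\<bar> \<le> int (M * n\<^sup>2)"
        using j(1) by linarith
      moreover have "count (mset w) l \<le> n" for l
        using count_le_size[of "mset w" l] n by simp
      then have "f \<in> ?L \<rightarrow>\<^sub>E {..n}"
        unfolding f_def by simp
      ultimately have "(f, j) \<in> ?P"
        by auto
      then show "g \<in> (\<lambda>(f, j). word_value G (rep f) \<otimes> r [^] j) ` ?P"
        using j(2) g by (intro image_eqI[of _ _ "(f, j)"]) simp_all
    qed
    moreover have "finite ?P"
      using S(1) by (intro finite_cartesian_product finite_PiE) auto
    ultimately have "card {word_value G w |w. w \<in> lists ?L \<and> length w \<le> n} \<le> card ?P"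
      by (meson card_image_le card_mono finite_imageI le_trans)
    also have "\<dots> = (n + 1) ^ card ?L * (2 * (M * n\<^sup>2) + 1)"
      unfolding card_cartesian_product card_interval
      using L by (simp add: card_PiE card_cartesian_product)
    also have "\<dots> \<le> (n + 1) ^ card ?L * ((2 * M + 1) * (n + 1)\<^sup>2)"
      by (intro mult_le_mono2) (simp add: power2_eq_square algebra_simps)
    also have "\<dots> = (2 * M + 1) * (n + 1) ^ (card ?L + 2)"
      by (simp only: power_add ac_simps)
    finally show ?thesis .
  qed
  then show ?thesis
    by blast
qed

end

text \<open>The logarithm of a polynomial in \<open>n\<close>, divided by \<open>n\<close>, tends to
  0. The bound is assumed for every finite generating set because \<open>exponential_growth\<close>
  supplies an unspecified one.\<close>

lemma not_exponential_growthI: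
  assumes poly: "\<And>S. finite_generating_set G S \<Longrightarrow>
    \<exists>C d. \<forall>n. card (word_ball G S n) \<le> C * (n + 1) ^ d"
  shows "\<not> exponential_growth G"
proof
  assume "exponential_growth G"
  then obtain S L where S: "finite_generating_set G S" and "L > 0"
    and L: "(\<lambda>n. ln (real (card (word_ball G S n))) / real n) \<longlonglongrightarrow> L"
    unfolding exponential_growth_def by blast
  obtain C d where C: "\<forall>n. card (word_ball G S n) \<le> C * (n + 1) ^ d"
    using poly[OF S] by blast
  \<comment> \<open>This is \<open>ln ((C + 1) * (2 * n) ^ d) / n\<close> expanded:
    \<open>n + 1 \<le> 2 * n\<close> for positive \<open>n\<close>, and \<open>C + 1\<close> keeps
    the argument of the logarithm positive.\<close>
  define u where "u n = ln (real (C + 1)) / real n + real d * (ln 2 / real n + ln (real n) / real n)"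
    for n
  have "(\<lambda>n. u n) \<longlonglongrightarrow> 0 + real d * (0 + 0)"
    unfolding u_def by (intro tendsto_intros lim_const_over_n
        filterlim_compose[OF ln_x_over_x_tendsto_0 filterlim_real_sequentially])
  then have u: "u \<longlonglongrightarrow> 0"
    by simp
  have "\<forall>\<^sub>F n in sequentially. ln (real (card (word_ball G S n))) / real n \<le> u n"
    using eventually_ge_at_top[of 1]
  proof eventually_elim
    case (elim n)
    have "ln (real (card (word_ball G S n))) \<le> ln (real (C + 1) * (2 * real n) ^ d)"
    proof (cases "card (word_ball G S n) = 0")
      \<comment> \<open>Here \<open>ln 0 = 0\<close>, so it suffices that the right-hand argument is
        at least 1.\<close>
      case True
      have "1 * 1 \<le> real (C + 1) * (2 * real n) ^ d"
        using elim by (intro mult_mono one_le_power) auto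
      then show ?thesis
        using True by simp
    next
      case False
      have "C * (n + 1) ^ d \<le> (C + 1) * (2 * n) ^ d"
        using elim by (intro mult_le_mono power_mono) auto
      then have "card (word_ball G S n) \<le> (C + 1) * (2 * n) ^ d"
        using C[rule_format, of n] by linarith
      then have "real (card (word_ball G S n)) \<le> real ((C + 1) * (2 * n) ^ d)"
        by (rule of_nat_mono)
      also have "\<dots> = real (C + 1) * (2 * real n) ^ d"
        by (simp add: distrib_right)
      finally show ?thesis
        using False elim by (subst ln_le_cancel_iff) simp_all
    qed
    also have "\<dots> = ln (real (C + 1)) + real d * (ln 2 + ln (real n))"
      using elim by (simp add: ln_mult ln_realpow distrib_left)
    finally have "ln (real (card (word_ball G S n))) / real n
        \<le> (ln (real (C + 1)) + real d * (ln 2 + ln (real n))) / real n"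
      using elim by (intro divide_right_mono) auto
    then show ?case
      by (simp add: u_def add_divide_distrib distrib_left)
  qed
  then have "L \<le> 0"
    using L u by (intro tendsto_le[OF _ u L]) auto
  then show False
    using \<open>L > 0\<close> by simp
qed

lemma (in group) word_value_subgroup_generated:
  assumes "w \<in> lists (UNIV \<times> carrier (subgroup_generated G T))"
  shows "word_value (subgroup_generated G T) w = word_value G w"
  using assms
proof (induction w)
  case (Cons l w)
  then show ?case
    by (cases l) simp
qed simp

text \<open>Both conditions range over the whole generated subgroup, since they are applied to the
  letters of an arbitrary generating set \<open>S\<close> rather than to \<open>T\<close>.\<close>

lemma (in group) not_exponential_growth_inverters:
  assumes r: "r \<in> carrier G"
    and inverters: "carrier (subgroup_generated G T) \<subseteq> inverters r"
    and comm: "\<And>x y. x \<in> carrier (subgroup_generated G T) \<Longrightarrow>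
      y \<in> carrier (subgroup_generated G T) \<Longrightarrow> \<exists>j::int. x \<otimes> y = y \<otimes> x \<otimes> r [^] j"
  shows "\<not> exponential_growth (subgroup_generated G T)"
proof (rule not_exponential_growthI)
  let ?H = "subgroup_generated G T"
  interpret H: group ?H
    by simp
  fix S assume S: "finite_generating_set ?H S"
  then have S': "finite S" "S \<subseteq> carrier ?H"
    unfolding finite_generating_set_def by auto
  have letter: "letter_value G l \<in> carrier ?H" if "l \<in> UNIV \<times> S" for l
  proof -
    have "snd l \<in> carrier ?H"
      using that S'(2) by auto
    then show ?thesis
      using H.letter_value_closed[of l] by (cases l) auto
  qed
  have comm': "\<exists>j::int.
      letter_value G l \<otimes> letter_value G m = letter_value G m \<otimes> letter_value G l \<otimes> r [^] j"
    if "l \<in> UNIV \<times> S" "m \<in> UNIV \<times> S" for l m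
    using comm letter that by blast
  have "S \<subseteq> inverters r"
    using S'(2) inverters by blast
  have "\<exists>C d. \<forall>n. card {word_value G w |w. w \<in> lists (UNIV \<times> S) \<and> length w \<le> n}
      \<le> C * (n + 1) ^ d"
    using comm' by (rule card_word_values_le[OF r S'(1) \<open>S \<subseteq> inverters r\<close>])
  then obtain C d where
    C: "\<forall>n. card {word_value G w |w. w \<in> lists (UNIV \<times> S) \<and> length w \<le> n} \<le> C * (n + 1) ^ d"
    by blast
  have "word_ball ?H S n \<subseteq> {word_value G w |w. w \<in> lists (UNIV \<times> S) \<and> length w \<le> n}" for n
  proof
    fix g assume g: "g \<in> word_ball ?H S n"
    then obtain w where w: "w \<in> lists (UNIV \<times> S)" "length w = word_length ?H S g"
      "word_value ?H w = g"
      using H.word_length_word[OF S, of g] unfolding word_ball_def by blast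
    have "word_length ?H S g \<le> n"
      using g carrier_subgroup_generated_subset[of T]
      unfolding word_ball_def word_dist_def by (auto simp: H.inv_one[simplified])
    moreover have "word_value G w = g"
      using w(3) word_value_subgroup_generated[OF lists_UNIV_Times_mono[OF w(1) S'(2)]] by simp
    ultimately show "g \<in> {word_value G w |w. w \<in> lists (UNIV \<times> S) \<and> length w \<le> n}"
      using w by auto
  qed
  moreover have "finite {word_value G w |w. w \<in> lists (UNIV \<times> S) \<and> length w \<le> n}" for n
  proof (rule finite_subset)
    show "{word_value G w |w. w \<in> lists (UNIV \<times> S) \<and> length w \<le> n}
      \<subseteq> word_value G ` {w. set w \<subseteq> UNIV \<times> S \<and> length w \<le> n}"
      by (auto simp: lists_eq_set)
    show "finite (word_value G ` {w. set w \<subseteq> UNIV \<times> S \<and> length w \<le> n})"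
      using S'(1) by (intro finite_imageI finite_lists_length_le) auto
  qed
  ultimately have "card (word_ball ?H S n) \<le> C * (n + 1) ^ d" for n
    using C[rule_format, of n] card_mono le_trans by meson
  then show "\<exists>C d. \<forall>n. card (word_ball ?H S n) \<le> C * (n + 1) ^ d"
    by blast
qed

section \<open>Free groups under monomorphisms\<close>

lemma word_value_hom:
  assumes "group G" "group H" "h \<in> hom G H" "w \<in> lists (UNIV \<times> carrier G)"
  shows "word_value H (map (apsnd h) w) = h (word_value G w)"
proof -
  interpret group_hom G H h
    using assms(1-3) by (simp add: group_hom_def group_hom_axioms_def)
  show ?thesis
    using assms(4)
  proof (induction w)
    case (Cons l w)
    obtain b x where l: "l = (b, x)"
      by (cases l)
    then have "x \<in> carrier G"
      using Cons.hyps by simp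
    then show ?case
      using Cons by (simp add: l)
  qed simp
qed

lemma free_group_iso:
  assumes free: "free_group G" and "group H" and h: "h \<in> iso G H"
  shows "free_group H"
proof -
  have "group G"
    using free unfolding free_group_def by simp
  obtain B where B: "B \<subseteq> carrier G"
    and bij: "bij_betw (word_value G) {w \<in> lists (UNIV \<times> B). reduced_word w} (carrier G)"
    using free unfolding free_group_def free_basis_def by blast
  have hom: "h \<in> hom G H" and bij_h: "bij_betw h (carrier G) (carrier H)"
    using h unfolding iso_def by auto
  have inj: "inj_on h B"
    using bij_h B by (meson bij_betw_imp_inj_on inj_on_subset)
  let ?W = "{w \<in> lists (UNIV \<times> B). reduced_word w}" and ?f = "map (apsnd h)"
  have apsnd: "inj_on (apsnd h) (UNIV \<times> B :: (bool \<times> _) set)"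
    using inj by (auto simp: inj_on_def)
  have inj_f: "inj_on ?f ?W"
  proof (rule inj_onI)
    fix v w assume "v \<in> ?W" "w \<in> ?W" "?f v = ?f w"
    moreover from this have "set v \<union> set w \<subseteq> UNIV \<times> B"
      by (auto simp: lists_eq_set)
    ultimately show "v = w"
      using apsnd by (metis inj_on_subset map_inj_on)
  qed
  have reduced: "reduced_word (?f w) = reduced_word w" if "w \<in> lists (UNIV \<times> B)" for w
  proof -
    have "h x = h y \<longleftrightarrow> x = y" if "(a, x) \<in> set w" "(b, y) \<in> set w" for a b x y
      using that \<open>w \<in> lists (UNIV \<times> B)\<close> inj_on_eq_iff[OF inj, of x y]
      by (auto dest!: in_listsD)
    then show ?thesis
      unfolding reduced_word_def successively_map
      by (intro successively_cong) (auto simp: split_beta)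
  qed
  have image: "{w \<in> lists (UNIV \<times> h ` B). reduced_word w} = ?f ` ?W"
  proof -
    have "(UNIV :: bool set) \<times> h ` B = apsnd h ` (UNIV \<times> B)"
      by force
    then have "lists ((UNIV :: bool set) \<times> h ` B) = ?f ` lists (UNIV \<times> B)"
      by (simp add: lists_image)
    then show ?thesis
      using reduced by (simp add: Compr_image_eq del: in_lists_conv_set cong: conj_cong)
  qed
  have "bij_betw (h \<circ> word_value G) ?W (carrier H)"
    using bij bij_h by (rule bij_betw_trans)
  moreover have "(word_value H \<circ> ?f) w = (h \<circ> word_value G) w" if "w \<in> ?W" for w
  proof -
    have "w \<in> lists (UNIV \<times> carrier G)"
      using lists_UNIV_Times_mono[OF _ B] that by blast
    then show ?thesis
      using word_value_hom[OF \<open>group G\<close> \<open>group H\<close> hom] by (simp only: comp_apply)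
  qed
  ultimately have "bij_betw (word_value H \<circ> ?f) ?W (carrier H)"
    using bij_betw_cong by blast
  then have "bij_betw (word_value H) (?f ` ?W) (carrier H)"
    using inj_f by (simp add: bij_betw_comp_iff[of ?f ?W "?f ` ?W"] bij_betw_imageI)
  moreover have "h ` B \<subseteq> carrier H"
    using B bij_h unfolding bij_betw_def by blast
  ultimately have "free_basis H (h ` B)"
    unfolding free_basis_def image by blast
  then show ?thesis
    using \<open>group H\<close> unfolding free_group_def by blast
qed

lemma mon_iso_subgroup_generated:
  assumes "group G" "group H" "h \<in> mon G H" "S \<subseteq> carrier G"
  shows "h \<in> iso (subgroup_generated G S) (subgroup_generated H (h ` S))"
proof -
  interpret group_hom G H h
    using assms(1-3) by (simp add: group_hom_def group_hom_axioms_def mon_def)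
  have "h ` S \<subseteq> carrier H"
    using assms(4) by auto
  then have carrier: "carrier (subgroup_generated G S) = generate G S"
    "carrier (subgroup_generated H (h ` S)) = generate H (h ` S)"
    using assms(4) by (simp_all add: carrier_subgroup_generated Int_absorb1)
  have sub: "generate G S \<subseteq> carrier G"
    using assms(4) G.generate_incl by blast
  have "h \<in> hom (subgroup_generated G S) (subgroup_generated H (h ` S))"
    using sub generate_img[OF assms(4)] by (auto simp: hom_def carrier subset_iff)
  moreover have "inj_on h (generate G S)"
    using sub assms(3) unfolding mon_def by (auto intro: inj_on_subset)
  ultimately show ?thesis
    using generate_img[OF assms(4)] by (auto simp: iso_def bij_betw_def carrier)
qed

lemma two_free_mon_image:
  assumes "two_free F" "group E" "i \<in> mon F E"
    and "u \<in> i ` carrier F" "v \<in> i ` carrier F"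
  shows "free_group (subgroup_generated E {u, v})"
proof -
  have "group F"
    using assms(1) unfolding two_free_def by simp
  obtain a b where ab: "a \<in> carrier F" "b \<in> carrier F" "u = i a" "v = i b"
    using assms(4,5) by auto
  then have "i \<in> iso (subgroup_generated F {a, b}) (subgroup_generated E {u, v})"
    using mon_iso_subgroup_generated[OF \<open>group F\<close> assms(2,3), of "{a, b}"] by simp
  moreover have "free_group (subgroup_generated F {a, b})"
    using assms(1) ab unfolding two_free_def by blast
  ultimately show ?thesis
    using free_group_iso assms(2) group.group_subgroup_generated by blast
qed

text \<open>Transports the cyclic centralizer from \<open>F\<close> to its image in
  \<open>E\<close>; it describes only the elements of that image which commute with
  \<open>c\<close>.\<close>

lemma mon_image_centralizer_cyclic:
  assumes "two_free F" "word_hyperbolic F" "group E" "i \<in> mon F E"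
    and c: "c \<in> i ` carrier F" "c \<noteq> \<one>\<^bsub>E\<^esub>"
  obtains r where "infinite_order E r" "r \<in> i ` carrier F"
    "\<And>g. g \<in> i ` carrier F \<Longrightarrow>
      g \<otimes>\<^bsub>E\<^esub> c = c \<otimes>\<^bsub>E\<^esub> g \<longleftrightarrow> (\<exists>k::int. g = r [^]\<^bsub>E\<^esub> k)"
proof -
  have "group F"
    using assms(1) unfolding two_free_def by simp
  interpret group_hom F E i
    using assms(3,4) \<open>group F\<close> by (simp add: group_hom_def group_hom_axioms_def mon_def)
  have inj: "i x = i y \<longleftrightarrow> x = y" if "x \<in> carrier F" "y \<in> carrier F" for x y
    using assms(4) that unfolding mon_def inj_on_def by blast
  obtain d where d: "d \<in> carrier F" "c = i d"
    using c(1) by blast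
  then have "d \<noteq> \<one>\<^bsub>F\<^esub>"
    using c(2) by auto
  then obtain r where r: "infinite_order F r"
    "\<And>g. g \<in> carrier F \<Longrightarrow> g \<otimes>\<^bsub>F\<^esub> d = d \<otimes>\<^bsub>F\<^esub> g \<longleftrightarrow> (\<exists>k::int. g = r [^]\<^bsub>F\<^esub> k)"
    using G.hyperbolic_centralizer_cyclic[OF assms(1,2) d(1)] by blast
  have rF: "r \<in> carrier F"
    using r(1) unfolding infinite_order_def by simp
  have pow: "i r [^]\<^bsub>E\<^esub> k = i (r [^]\<^bsub>F\<^esub> k)" for k :: int
    using hom_int_pow[OF rF] by simp
  show thesis
  proof (rule that[of "i r"])
    show "infinite_order E (i r)"
      using r(1) inj[of _ "\<one>\<^bsub>F\<^esub>"] rF unfolding infinite_order_def by (auto simp: pow)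
    show "i r \<in> i ` carrier F"
      using rF by simp
    fix g assume "g \<in> i ` carrier F"
    then obtain x where x: "x \<in> carrier F" "g = i x"
      by blast
    then have "g \<otimes>\<^bsub>E\<^esub> c = c \<otimes>\<^bsub>E\<^esub> g \<longleftrightarrow> x \<otimes>\<^bsub>F\<^esub> d = d \<otimes>\<^bsub>F\<^esub> x"
      using inj[of "x \<otimes>\<^bsub>F\<^esub> d" "d \<otimes>\<^bsub>F\<^esub> x"] d by simp
    also have "\<dots> \<longleftrightarrow> (\<exists>k::int. g = i r [^]\<^bsub>E\<^esub> k)"
      using r(2)[OF x(1)] inj x rF by (simp add: pow)
    finally show "g \<otimes>\<^bsub>E\<^esub> c = c \<otimes>\<^bsub>E\<^esub> g \<longleftrightarrow> (\<exists>k::int. g = i r [^]\<^bsub>E\<^esub> k)" .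
  qed
qed

section \<open>Short words generating a free group\<close>

context group
begin

text \<open>The powers of \<open>r\<close> form a normal subgroup of \<open>inverters r\<close>, and
  the set here is the preimage of the centralizer of \<open>x\<close> in the quotient.\<close>

lemma subgroup_commuting_mod_powers:
  assumes r: "r \<in> carrier G" and x: "x \<in> inverters r"
  shows "subgroup {y \<in> inverters r. \<exists>j::int. x \<otimes> y = y \<otimes> x \<otimes> r [^] j} G"
    (is "subgroup ?Y G")
proof (rule subgroupI)
  note inverters = subgroup_inverters[OF r]
  have inverters_carrier: "y \<in> carrier G" if "y \<in> inverters r" for y
    using that unfolding inverters_def by simp
  have xG: "x \<in> carrier G"
    using x by (rule inverters_carrier)
  show "?Y \<subseteq> carrier G"
    using inverters_carrier by blast
  have "\<one> \<in> ?Y"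
    using subgroup.one_closed[OF inverters] xG by (auto intro!: exI[of _ 0])
  then show "?Y \<noteq> {}"
    by blast
  fix a assume "a \<in> ?Y"
  then obtain j :: int where a: "a \<in> inverters r" and j: "x \<otimes> a = a \<otimes> x \<otimes> r [^] j"
    by blast
  have aG: "a \<in> carrier G"
    using a by (rule inverters_carrier)
  have inv_a: "inv a \<in> inverters r"
    using a by (rule subgroup.m_inv_closed[OF inverters])
  obtain j' where j': "r [^] j \<otimes> inv a = inv a \<otimes> r [^] (j' :: int)"
    using inverters_int_pow[OF r inv_a] .
  have "inv a \<otimes> x = inv a \<otimes> (x \<otimes> a) \<otimes> inv a"
    using xG aG by (simp add: m_assoc)
  also have "\<dots> = x \<otimes> (r [^] j \<otimes> inv a)"
    using xG aG r by (simp add: j m_assoc)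
  finally have "inv a \<otimes> x = x \<otimes> inv a \<otimes> r [^] j'"
    using xG aG r by (simp add: j' m_assoc)
  then have "x \<otimes> inv a = inv a \<otimes> x \<otimes> r [^] (- j')"
    using xG aG r by (simp add: m_assoc int_pow_neg)
  then show "inv a \<in> ?Y"
    using inv_a by blast
  fix b assume "b \<in> ?Y"
  then obtain k :: int where b: "b \<in> inverters r" and k: "x \<otimes> b = b \<otimes> x \<otimes> r [^] k"
    by blast
  have bG: "b \<in> carrier G"
    using b by (rule inverters_carrier)
  obtain l where l: "r [^] j \<otimes> b = b \<otimes> r [^] (l :: int)"
    using inverters_int_pow[OF r b] .
  have "x \<otimes> (a \<otimes> b) = a \<otimes> x \<otimes> (r [^] j \<otimes> b)"
    using xG aG bG r by (simp add: j flip: m_assoc)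
  also have "\<dots> = a \<otimes> (x \<otimes> b) \<otimes> r [^] l"
    using xG aG bG r by (simp add: l m_assoc)
  also have "\<dots> = a \<otimes> b \<otimes> x \<otimes> r [^] (k + l)"
    using xG aG bG r by (simp add: k m_assoc int_pow_mult)
  finally show "a \<otimes> b \<in> ?Y"
    using subgroup.m_closed[OF inverters a b] by blast
qed

text \<open>Commutation modulo powers of \<open>r\<close> is extended from \<open>T\<close> to the
  generated subgroup in one argument, the arguments are swapped, and it is then extended in the
  other.\<close>

lemma commuting_mod_powers_generate:
  assumes r: "r \<in> carrier G" and T: "T \<subseteq> inverters r"
    and comm: "\<And>s t. s \<in> T \<Longrightarrow> t \<in> T \<Longrightarrow> \<exists>j::int. s \<otimes> t = t \<otimes> s \<otimes> r [^] j"
    and x: "x \<in> generate G T" and y: "y \<in> generate G T"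
  shows "\<exists>j::int. x \<otimes> y = y \<otimes> x \<otimes> r [^] j"
proof -
  have gen: "generate G T \<subseteq> inverters r"
    using generate_subgroup_incl[OF T subgroup_inverters[OF r]] .
  then have carrier: "g \<in> carrier G" if "g \<in> generate G T" for g
    using that unfolding inverters_def by blast
  have "\<exists>j::int. s \<otimes> g = g \<otimes> s \<otimes> r [^] j" if "s \<in> T" "g \<in> generate G T" for s g
    using generate_subgroup_incl[OF _ subgroup_commuting_mod_powers[OF r, of s], of T] T comm that
    by blast
  moreover have "\<exists>j::int. h \<otimes> g = g \<otimes> h \<otimes> r [^] j"
    if "g \<otimes> h = h \<otimes> g \<otimes> r [^] (j::int)" "g \<in> carrier G" "h \<in> carrier G" for g h j
    using that r by (intro exI[of _ "- j"]) (simp add: m_assoc int_pow_neg)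
  ultimately have "\<exists>j::int. x \<otimes> t = t \<otimes> x \<otimes> r [^] j" if "t \<in> T" for t
    using that x carrier generate.incl[of t T G] by blast
  then show ?thesis
    using generate_subgroup_incl[OF _ subgroup_commuting_mod_powers[OF r, of x], of T] T gen x y
    by blast
qed

text \<open>Conjugating by \<open>u\<close> and back gives \<open>r = r [^] (b * a)\<close>, so
  infinite order forces \<open>b * a = 1\<close>. Having both conjugates excludes that
  \<open>u\<close> sends \<open>r\<close> to a proper power.\<close>

lemma inverters_from_conjugates:
  assumes r: "infinite_order G r" and u: "u \<in> carrier G"
    and a: "inv u \<otimes> r \<otimes> u = r [^] (a::int)" and b: "u \<otimes> r \<otimes> inv u = r [^] (b::int)"
  shows "u \<in> inverters r"
proof -
  have rG: "r \<in> carrier G" and order: "\<And>k::int. r [^] k = \<one> \<Longrightarrow> k = 0"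
    using r unfolding infinite_order_def by auto
  have "(\<lambda>x. u \<otimes> x \<otimes> inv u) \<in> hom G G"
    using u by (auto simp: hom_def m_assoc)
  then have "u \<otimes> r [^] a \<otimes> inv u = (u \<otimes> r \<otimes> inv u) [^] a"
    using hom_int_pow[of "\<lambda>x. u \<otimes> x \<otimes> inv u" G G r a] rG is_group by simp
  moreover have "u \<otimes> r [^] a \<otimes> inv u = r"
    using u rG by (simp add: m_assoc flip: a)
  ultimately have "r [^] (b * a) = r"
    using rG by (simp add: b int_pow_pow)
  then have "r [^] (b * a - 1) = \<one>"
    using rG by (simp add: int_pow_diff)
  then have "b * a = 1"
    using order by fastforce
  then have "a = 1 \<or> a = - 1"
    by (auto simp: zmult_eq_1_iff)
  moreover have "r \<otimes> u = u \<otimes> r [^] a"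
    using u rG by (simp add: m_assoc flip: a)
  ultimately show ?thesis
    using u rG int_pow_neg[OF rG, of 1] unfolding inverters_def by auto
qed

end

section \<open>Short non-commuting words, or else commutation modulo a cyclic subgroup\<close>

theorem theorem3p2:
  fixes F :: "('f, 'm) monoid_scheme"
    and E :: "('e, 'n) monoid_scheme"
    and A :: "('a, 'k) monoid_scheme"
    and i :: "'f \<Rightarrow> 'e" and p :: "'e \<Rightarrow> 'a"
    and T :: "'e set"
  assumes "group F" and "two_free F" and "word_hyperbolic F"
    and "comm_group A"
    and "group E" and "short_exact F E A i p"
    and "finite T" and "T \<subseteq> carrier E"
    and "exponential_growth (subgroup_generated E T)"
  shows "\<exists>U \<subseteq> carrier (subgroup_generated E T).
           (\<forall>u\<in>U. \<exists>w \<in> lists (UNIV \<times> T). length w \<le> 6 \<and> word_value E w = u) \<and>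
           free_group (subgroup_generated E U) \<and>
           \<not> comm_group (subgroup_generated E U)"
proof (rule ccontr)
  assume no_free: "\<not> ?thesis"
  interpret E: group E
    by fact
  interpret A: comm_group A
    by fact
  interpret p: group_hom E A p
    using assms(6) E.is_group A.is_group
    by (simp add: group_hom_def group_hom_axioms_def short_exact_def epi_def)
  define N where "N = i ` carrier F"
  have i: "i \<in> mon F E" and N: "N = kernel E A p"
    using assms(6) unfolding short_exact_def N_def by simp_all
  have NE: "g \<in> carrier E" if "g \<in> N" for g
    using that unfolding N kernel_def by simp
  have conj_N: "x \<otimes>\<^bsub>E\<^esub> g \<otimes>\<^bsub>E\<^esub> inv\<^bsub>E\<^esub> x \<in> N" if "x \<in> carrier E" "g \<in> N" for x g
    using that p.normal_kernel unfolding N by (simp add: E.normal_inv_iff)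
  \<comment> \<open>Commutators die in the abelian quotient \<open>A\<close>, so they lie in its
    kernel \<open>N\<close>.\<close>
  have comm_N: "x \<otimes>\<^bsub>E\<^esub> (y \<otimes>\<^bsub>E\<^esub> (inv\<^bsub>E\<^esub> x \<otimes>\<^bsub>E\<^esub> inv\<^bsub>E\<^esub> y)) \<in> N"
    if "x \<in> carrier E" "y \<in> carrier E" for x y
  proof -
    have "p x \<otimes>\<^bsub>A\<^esub> (p y \<otimes>\<^bsub>A\<^esub> (inv\<^bsub>A\<^esub> p x \<otimes>\<^bsub>A\<^esub> inv\<^bsub>A\<^esub> p y)) = \<one>\<^bsub>A\<^esub>"
      using that by (simp add: A.m_lcomm[of "p y"])
    then show ?thesis
      using that unfolding N kernel_def by simp
  qed
  have T: "T \<subseteq> carrier E"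
    by fact
  have carrier_T: "carrier (subgroup_generated E T) = generate E T"
    using T by (simp add: carrier_subgroup_generated Int_absorb1)
  \<comment> \<open>Two such values generate a free group because they lie in the image of the
    2-free group \<open>F\<close>; if they did not commute, they would form the set \<open>U\<close>
    that \<open>no_free\<close> excludes.\<close>
  have short_commute: "word_value E v \<otimes>\<^bsub>E\<^esub> word_value E w = word_value E w \<otimes>\<^bsub>E\<^esub> word_value E v"
    if v: "v \<in> lists (UNIV \<times> T)" "length v \<le> 6" "word_value E v \<in> N"
      and w: "w \<in> lists (UNIV \<times> T)" "length w \<le> 6" "word_value E w \<in> N" for v w
  proof (rule ccontr)
    assume noncomm: "\<not> ?thesis"
    let ?U = "{word_value E v, word_value E w}"
    have "?U \<subseteq> carrier (subgroup_generated E T)"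
      using E.word_value_in_generate[OF T] v(1) w(1) by (simp add: carrier_T)
    moreover have "\<forall>u\<in>?U. \<exists>w \<in> lists (UNIV \<times> T). length w \<le> 6 \<and> word_value E w = u"
      using v w by blast
    moreover have "free_group (subgroup_generated E ?U)"
      using two_free_mon_image[OF assms(2,5) i] v(3) w(3) unfolding N_def by blast
    moreover have "\<not> comm_group (subgroup_generated E ?U)"
    proof
      assume "comm_group (subgroup_generated E ?U)"
      moreover have "?U \<subseteq> carrier (subgroup_generated E ?U)"
        using NE v(3) w(3) by (auto simp: carrier_subgroup_generated intro: generate.incl)
      ultimately show False
        using noncomm comm_groupE(4) by fastforce
    qed
    ultimately show False
      using no_free by blast
  qed
  have "\<exists>r\<in>carrier E. T \<subseteq> E.inverters r \<and>
    (\<forall>s\<in>T. \<forall>t\<in>T. \<exists>j::int. s \<otimes>\<^bsub>E\<^esub> t = t \<otimes>\<^bsub>E\<^esub> s \<otimes>\<^bsub>E\<^esub> r [^]\<^bsub>E\<^esub> j)"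
  proof (cases "\<forall>s\<in>T. \<forall>t\<in>T. s \<otimes>\<^bsub>E\<^esub> t = t \<otimes>\<^bsub>E\<^esub> s")
    case True
    \<comment> \<open>For commutative \<open>T\<close> the trivial element serves as
      \<open>r\<close>, with all exponents 0.\<close>
    have "T \<subseteq> E.inverters \<one>\<^bsub>E\<^esub>"
      using T unfolding E.inverters_def by auto
    moreover have "s \<otimes>\<^bsub>E\<^esub> t = t \<otimes>\<^bsub>E\<^esub> s \<otimes>\<^bsub>E\<^esub> \<one>\<^bsub>E\<^esub> [^]\<^bsub>E\<^esub> (0::int)" if "s \<in> T" "t \<in> T" for s t
      using True that T by (simp add: subset_iff)
    ultimately show ?thesis
      by (meson E.one_closed)
  next
    case False
    then obtain s t where st: "s \<in> T" "t \<in> T" "s \<otimes>\<^bsub>E\<^esub> t \<noteq> t \<otimes>\<^bsub>E\<^esub> s"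
      by blast
    then have stE: "s \<in> carrier E" "t \<in> carrier E"
      using T by auto
    \<comment> \<open>The commutator has length 4, which leaves two letters for a conjugation within
      the bound 6.\<close>
    define cw where "cw = [(True, s), (True, t), (False, s), (False, t)]"
    define c where "c = word_value E cw"
    have cw: "cw \<in> lists (UNIV \<times> T)"
      using st by (simp add: cw_def)
    have len_cw: "length cw = 4"
      by (simp add: cw_def)
    have c: "c = s \<otimes>\<^bsub>E\<^esub> (t \<otimes>\<^bsub>E\<^esub> (inv\<^bsub>E\<^esub> s \<otimes>\<^bsub>E\<^esub> inv\<^bsub>E\<^esub> t))"
      using stE by (simp add: c_def cw_def)
    have cN: "c \<in> N"
      unfolding c using stE by (rule comm_N)
    have "c \<otimes>\<^bsub>E\<^esub> (t \<otimes>\<^bsub>E\<^esub> s) = s \<otimes>\<^bsub>E\<^esub> t"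
      using stE by (simp add: c E.m_assoc)
    then have "c \<noteq> \<one>\<^bsub>E\<^esub>"
      using st(3) stE by auto
    then obtain r where r: "infinite_order E r" "r \<in> N"
      and root: "\<And>g. g \<in> N \<Longrightarrow> g \<otimes>\<^bsub>E\<^esub> c = c \<otimes>\<^bsub>E\<^esub> g \<longleftrightarrow> (\<exists>k::int. g = r [^]\<^bsub>E\<^esub> k)"
      using mon_image_centralizer_cyclic[OF assms(2,3,5) i] cN unfolding N_def by metis
    have rE: "r \<in> carrier E" and cE: "c \<in> carrier E"
      using NE r(2) cN by auto
    \<comment> \<open>Stated for letters, so that it applies to an element of \<open>T\<close> as
      well as to its inverse.\<close>
    have conj_r: "\<exists>k::int. inv\<^bsub>E\<^esub> u \<otimes>\<^bsub>E\<^esub> r \<otimes>\<^bsub>E\<^esub> u = r [^]\<^bsub>E\<^esub> k"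
      if l: "l \<in> UNIV \<times> T" and u: "u = letter_value E l" for l u
    proof -
      let ?l' = "apfst Not l"
      have lT: "snd l \<in> T"
        using l by auto
      have lE: "snd l \<in> carrier E"
        using lT T by blast
      have uE: "u \<in> carrier E"
        using lE by (simp add: u)
      have l': "letter_value E ?l' = inv\<^bsub>E\<^esub> u"
        using lE by (cases l) (simp add: u)
      define d where "d = u \<otimes>\<^bsub>E\<^esub> c \<otimes>\<^bsub>E\<^esub> inv\<^bsub>E\<^esub> u"
      have dN: "d \<in> N"
        unfolding d_def using uE cN by (rule conj_N)
      \<comment> \<open>This word for the conjugate \<open>d\<close> of \<open>c\<close> has length
        exactly 6.\<close>
      have dw: "l # cw @ [?l'] \<in> lists (UNIV \<times> T)"
        using l lT cw by (simp add: mem_Times_iff)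
      have "word_value E (cw @ [?l']) = c \<otimes>\<^bsub>E\<^esub> inv\<^bsub>E\<^esub> u"
        using lE uE lists_UNIV_Times_mono[OF cw T]
        by (subst E.word_value_append) (simp_all add: l' c_def mem_Times_iff)
      then have d: "word_value E (l # cw @ [?l']) = d"
        using uE cE by (simp add: d_def E.m_assoc flip: u)
      have "d \<otimes>\<^bsub>E\<^esub> c = c \<otimes>\<^bsub>E\<^esub> d"
        using short_commute[OF dw _ _ cw, unfolded d, folded c_def] dN cN len_cw by simp
      then obtain k :: int where k: "d = r [^]\<^bsub>E\<^esub> k"
        using root[OF dN] by blast
      then have rd: "r \<otimes>\<^bsub>E\<^esub> d = d \<otimes>\<^bsub>E\<^esub> r"
        using E.int_pow_mult[OF rE, of 1 k] E.int_pow_mult[OF rE, of k 1] rE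
        by (simp add: add.commute)
      \<comment> \<open>As \<open>r\<close> commutes with \<open>d\<close>, conjugating back shows
        that \<open>x\<close> commutes with \<open>c\<close>; since \<open>x\<close> lies in
        \<open>N\<close>, it is a power of \<open>r\<close>.\<close>
      define x where "x = inv\<^bsub>E\<^esub> u \<otimes>\<^bsub>E\<^esub> r \<otimes>\<^bsub>E\<^esub> u"
      have c_eq: "c = inv\<^bsub>E\<^esub> u \<otimes>\<^bsub>E\<^esub> d \<otimes>\<^bsub>E\<^esub> u"
        using uE cE by (simp add: d_def E.m_assoc)
      have "x \<otimes>\<^bsub>E\<^esub> c = inv\<^bsub>E\<^esub> u \<otimes>\<^bsub>E\<^esub> (r \<otimes>\<^bsub>E\<^esub> d) \<otimes>\<^bsub>E\<^esub> u"
        using uE rE NE[OF dN] by (simp add: c_eq x_def E.m_assoc)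
      also have "\<dots> = c \<otimes>\<^bsub>E\<^esub> x"
        using uE rE NE[OF dN] by (simp add: rd c_eq x_def E.m_assoc)
      finally have "x \<otimes>\<^bsub>E\<^esub> c = c \<otimes>\<^bsub>E\<^esub> x" .
      moreover have "x \<in> N"
        using conj_N[of "inv\<^bsub>E\<^esub> u" r] uE r(2) by (simp add: x_def)
      ultimately show ?thesis
        using root unfolding x_def by blast
    qed
    have "u \<in> E.inverters r" if uT: "u \<in> T" for u
    proof -
      have uE: "u \<in> carrier E"
        using uT T by blast
      obtain a :: int where "inv\<^bsub>E\<^esub> u \<otimes>\<^bsub>E\<^esub> r \<otimes>\<^bsub>E\<^esub> u = r [^]\<^bsub>E\<^esub> a"
        using conj_r[of "(True, u)" u] uT by auto
      moreover obtain b :: int where "u \<otimes>\<^bsub>E\<^esub> r \<otimes>\<^bsub>E\<^esub> inv\<^bsub>E\<^esub> u = r [^]\<^bsub>E\<^esub> b"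
        using conj_r[of "(False, u)" "inv\<^bsub>E\<^esub> u"] uT uE by auto
      ultimately show ?thesis
        by (rule E.inverters_from_conjugates[OF r(1) uE])
    qed
    moreover have "\<exists>j::int. x \<otimes>\<^bsub>E\<^esub> y = y \<otimes>\<^bsub>E\<^esub> x \<otimes>\<^bsub>E\<^esub> r [^]\<^bsub>E\<^esub> j" if "x \<in> T" "y \<in> T" for x y
    proof -
      have xy: "x \<in> carrier E" "y \<in> carrier E"
        using that T by auto
      \<comment> \<open>With the inverses in front, the commutator is the correction factor on the
        right: \<open>x \<otimes> y = y \<otimes> x \<otimes> z\<close>.\<close>
      define z where "z = inv\<^bsub>E\<^esub> x \<otimes>\<^bsub>E\<^esub> (inv\<^bsub>E\<^esub> y \<otimes>\<^bsub>E\<^esub> (x \<otimes>\<^bsub>E\<^esub> y))"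
      have zN: "z \<in> N"
        using comm_N[of "inv\<^bsub>E\<^esub> x" "inv\<^bsub>E\<^esub> y"] xy by (simp add: z_def)
      let ?zw = "[(False, x), (False, y), (True, x), (True, y)]"
      have z: "word_value E ?zw = z"
        using xy by (simp add: z_def)
      have zw: "?zw \<in> lists (UNIV \<times> T)"
        using that by simp
      have "z \<otimes>\<^bsub>E\<^esub> c = c \<otimes>\<^bsub>E\<^esub> z"
        using short_commute[OF zw _ _ cw, unfolded z, folded c_def] zN cN len_cw by simp
      then obtain j :: int where "z = r [^]\<^bsub>E\<^esub> j"
        using root[OF zN] by blast
      moreover have "x \<otimes>\<^bsub>E\<^esub> y = y \<otimes>\<^bsub>E\<^esub> x \<otimes>\<^bsub>E\<^esub> z"
        using xy by (simp add: z_def E.m_assoc)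
      ultimately show ?thesis
        by blast
    qed
    ultimately show ?thesis
      using rE by blast
  qed
  then obtain r where r: "r \<in> carrier E" "T \<subseteq> E.inverters r"
    and comm: "\<And>s t. s \<in> T \<Longrightarrow> t \<in> T \<Longrightarrow>
      \<exists>j::int. s \<otimes>\<^bsub>E\<^esub> t = t \<otimes>\<^bsub>E\<^esub> s \<otimes>\<^bsub>E\<^esub> r [^]\<^bsub>E\<^esub> j"
    by blast
  \<comment> \<open>What holds for \<open>T\<close> is extended to the whole generated subgroup,
    where the growth estimate applies to every finite generating set.\<close>
  have "generate E T \<subseteq> E.inverters r"
    using E.generate_subgroup_incl[OF r(2) E.subgroup_inverters[OF r(1)]] .
  moreover have "\<exists>j::int. x \<otimes>\<^bsub>E\<^esub> y = y \<otimes>\<^bsub>E\<^esub> x \<otimes>\<^bsub>E\<^esub> r [^]\<^bsub>E\<^esub> j"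
    if "x \<in> generate E T" "y \<in> generate E T" for x y
    by (rule E.commuting_mod_powers_generate[OF r _ that]) (rule comm)
  ultimately have "\<not> exponential_growth (subgroup_generated E T)"
    by (rule E.not_exponential_growth_inverters[OF r(1), where T = T, unfolded carrier_T])
  then show False
    using assms(9) by contradiction
qed

end
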